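(* There exists a constant $C>0$ such that for every $n\in\mathbb{N}_0$ $$\|Zh_n\|_{L^\infty([0,1]^2)}\le C\,(n+1)^{1/4}.$$
   Context: $\mathbb{N}_0=\{0,1,2,\dots\}$. Hermite functions: for $n\in\mathbb{N}_0$, $h_n(t)=C_n e^{\pi t^2}\frac{d^n}{dt^n}\big(e^{-2\pi t^2}\big)$, $t\in\mathbb{R}$, where the real constant $C_n$ has sign $(-1)^n$ and is chosen so that $\|h_n\|_{L^2(\mathbb{R})}=1$. Zak transform of a function $f\in L^2(\mathbb{R})$: $Zf(x,y)=\sum_{k\in\mathbb{Z}}f(x+k)e^{2\pi i k y}$. *)

theory Defs
  imports "HOL-Analysis.Analysis" "HOL-Probability.Essential_Supremum"
begin

text \<open>If \<open>f\<close> is not square integrable, the Bochner integral below is \<open>0\<close>; in particular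
  \<open>L2_norm f = 1\<close> entails square integrability.\<close>

definition L2_norm :: "(real \<Rightarrow> real) \<Rightarrow> real" where
  "L2_norm f = sqrt (\<integral>t. (f t)\<^sup>2 \<partial>lebesgue)"

definition hermite_unnorm :: "nat \<Rightarrow> real \<Rightarrow> real" where
  "hermite_unnorm n t = exp (pi * t\<^sup>2) * (deriv ^^ n) (\<lambda>s. exp (- 2 * pi * s\<^sup>2)) t"

definition hermite_const :: "nat \<Rightarrow> real" where
  "hermite_const n = (THE c. sgn c = (- 1) ^ n \<and> L2_norm (\<lambda>t. c * hermite_unnorm n t) = 1)"

definition hermite_fun :: "nat \<Rightarrow> real \<Rightarrow> real" where
  "hermite_fun n t = hermite_const n * hermite_unnorm n t"

text \<open>The bilateral series is read as the limit of its symmetric partial sums. For square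
  integrable \<open>f\<close> these converge almost everywhere (Carleson) to the limit in \<open>L\<^sup>2([0,1]\<^sup>2)\<close>,
  whereas absolute convergence, and hence \<^const>\<open>infsum\<close>, is not available for every such \<open>f\<close>;
  for Hermite functions the series converges absolutely at every point.\<close>

definition Zak :: "(real \<Rightarrow> complex) \<Rightarrow> real \<times> real \<Rightarrow> complex" where
  "Zak f = (\<lambda>(x, y). lim (\<lambda>N::nat. \<Sum>k = - int N..int N.
      f (x + of_int k) * exp (2 * of_real pi * \<i> * of_int k * of_real y)))"

text \<open>The norm is valued in the extended nonnegative reals. By the convention of \<^const>\<open>esssup\<close>
  it is infinite when \<open>f\<close> is not measurable, so a finite bound includes measurability.\<close>

definition Linfty_norm :: "'a measure \<Rightarrow> ('a \<Rightarrow> complex) \<Rightarrow> ennreal" where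
  "Linfty_norm M f = esssup M (\<lambda>z. ennreal (norm (f z)))"

end

theory Submission
  imports Defs "HOL-Probability.Distributions" "HOL-Computational_Algebra.Polynomial"
begin

text \<open>The Zak transform is bounded by the absolute lattice sum \<open>\<Sum>\<^sub>k |h\<^sub>n(x + k)|\<close>, which
  already has the claimed order: \<open>h\<^sub>n\<close> lives on \<open>|t| \<le> r\<close> with
  \<open>r\<close> of order \<open>n\<^sup>1\<^sup>/\<^sup>2\<close>, its typical size there is \<open>r\<^sup>-\<^sup>1\<^sup>/\<^sup>2\<close>, and so the sum has order \<open>r\<^sup>1\<^sup>/\<^sup>2\<close>.

  To make this precise, only the oscillator equation \<open>h'' = 4\<pi>\<^sup>2(t\<^sup>2 - r\<^sup>2) h\<close> with
  \<open>r\<^sup>2 = (2n + 1)/(2\<pi>)\<close>, the normalisation and the parity of \<open>h = h\<^sub>n\<close> are used, instead of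
  asymptotics of Hermite polynomials.

  The energy \<open>E = 4\<pi>\<^sup>2(r\<^sup>2 - t\<^sup>2) h\<^sup>2 + h'\<^sup>2\<close> decreases on \<open>t \<ge> 0\<close>, at the rate \<open>8\<pi>\<^sup>2 t h\<^sup>2\<close>. A
  virial identity for \<open>t E - h h'\<close> controls \<open>E(r)\<close> by the mass of \<open>h\<close>, and the total loss of \<open>E\<close>
  over \<open>[0, r]\<close> is controlled by the mass as well; together \<open>E \<le> 16\<pi>\<^sup>2 r\<close> on \<open>t \<ge> 0\<close>
  (\<open>energy_le\<close>). Before the turning point this gives
  \<open>|h(t)| \<le> 2 (r - t)\<^sup>-\<^sup>1\<^sup>/\<^sup>2\<close> (\<open>abs_le_inside\<close>), whose sum over a unit lattice is \<open>O(r\<^sup>1\<^sup>/\<^sup>2)\<close>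
  because the singularity is integrable. The boundedly many lattice points near the turning point
  only need \<open>|h| \<le> 24 r\<^sup>1\<^sup>/\<^sup>2\<close> (\<open>abs_le_sup\<close>), which follows by integrating \<open>|h'| \<le> E\<^sup>1\<^sup>/\<^sup>2\<close> over
  a unit length. Past the turning point \<open>h\<^sup>2\<close> is convex with finite integral, hence decreasing, and
  strong convexity makes \<open>h\<close> decay geometrically (\<open>abs_le_outside\<close>).\<close>

section \<open>Solutions of the oscillator equation with a turning point\<close>

text \<open>Parity of \<open>h\<close> enters the estimates through \<open>h(0) h'(0) = 0\<close>, which is what allows all estimates to be
  made on the half-line. The lower bound for \<open>r\<close> keeps \<open>r\<^sup>1\<^sup>/\<^sup>2\<close> comparable to constants; the value
  \<open>1/3\<close> is below the turning point \<open>(2\<pi>)\<^sup>-\<^sup>1\<^sup>/\<^sup>2\<close> of the Gaussian \<open>h\<^sub>0\<close>.\<close>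

locale oscillator_solution =
  fixes r :: real and h d :: "real \<Rightarrow> real"
  assumes r_ge: "1 / 3 \<le> r"
    and h_deriv: "\<And>t. (h has_real_derivative d t) (at t)"
    and d_deriv: "\<And>t. (d has_real_derivative 4 * pi\<^sup>2 * (t\<^sup>2 - r\<^sup>2) * h t) (at t)"
    and flat_at_0: "h 0 * d 0 = 0"
    and mass_le_1: "\<And>a b. 0 \<le> a \<Longrightarrow> a \<le> b \<Longrightarrow> integral {a..b} (\<lambda>t. (h t)\<^sup>2) \<le> 1"
begin

lemma r_pos: "0 < r"
  using r_ge by linarith

lemma square_deriv: "((\<lambda>t. (h t)\<^sup>2) has_real_derivative 2 * (h t * d t)) (at t)"
  by (rule derivative_eq_intros h_deriv refl | simp)+

lemma square_deriv2:
  "((\<lambda>t. 2 * (h t * d t)) has_real_derivative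
      2 * (d t)\<^sup>2 + 8 * pi\<^sup>2 * (t\<^sup>2 - r\<^sup>2) * (h t)\<^sup>2) (at t)"
  by (rule derivative_eq_intros h_deriv d_deriv refl | simp add: power2_eq_square algebra_simps)+

text \<open>The way in which the normalisation is used: a quantity growing at most as fast as \<open>c h\<^sup>2\<close>
  grows by at most \<open>c\<close> in total.\<close>

lemma increment_le_mass:
  assumes "0 \<le> a" "a \<le> b" "0 \<le> c"
    and F: "\<And>t. a \<le> t \<Longrightarrow> t \<le> b \<Longrightarrow> (F has_real_derivative F' t) (at t)"
    and le: "\<And>t. a \<le> t \<Longrightarrow> t \<le> b \<Longrightarrow> F' t \<le> c * (h t)\<^sup>2"
  shows "F b - F a \<le> c"
proof -
  have "continuous_on {a..b} (\<lambda>t. (h t)\<^sup>2)"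
    by (rule continuous_at_imp_continuous_on) (blast intro: DERIV_isCont square_deriv)
  then have int: "((\<lambda>t. (h t)\<^sup>2) has_integral integral {a..b} (\<lambda>t. (h t)\<^sup>2)) {a..b}"
    by (intro integrable_integral integrable_continuous_real)
  have "(F' has_integral (F b - F a)) {a..b}"
    by (intro fundamental_theorem_of_calculus assms(2))
      (use F in \<open>auto simp: has_real_derivative_iff_has_vector_derivative[symmetric]
        intro: has_field_derivative_at_within\<close>)
  then have "F b - F a \<le> c * integral {a..b} (\<lambda>t. (h t)\<^sup>2)"
    by (rule has_integral_le[OF _ has_integral_mult_right[OF int]]) (use le in auto)
  also have "\<dots> \<le> c * 1"
    using mass_le_1[of a b] assms by (intro mult_left_mono) auto
  finally show ?thesis by simp
qed

text \<open>Convexity of \<open>h\<^sup>2\<close> past the turning point, where both terms of its second derivative are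
  nonnegative.\<close>

lemma square_deriv_mono:
  assumes "r \<le> s" "s \<le> t"
  shows "h s * d s \<le> h t * d t"
proof -
  have "2 * (h s * d s) \<le> 2 * (h t * d t)"
  proof (rule DERIV_nonneg_imp_nondecreasing[OF assms(2)])
    fix u assume "s \<le> u" "u \<le> t"
    then have "r\<^sup>2 \<le> u\<^sup>2" using assms r_pos by (intro power_mono) auto
    then show "\<exists>y. ((\<lambda>t. 2 * (h t * d t)) has_real_derivative y) (at u) \<and> 0 \<le> y"
      by - (rule exI, intro conjI, rule square_deriv2, auto)
  qed
  then show ?thesis by simp
qed

text \<open>If the convex function \<open>h\<^sup>2\<close> increased anywhere past \<open>r\<close>, it would stay above a positive
  constant from there on, which the bounded mass forbids. This takes the place of a decay
  condition at infinity.\<close>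

lemma square_deriv_nonpos:
  assumes "r \<le> s"
  shows "h s * d s \<le> 0"
proof (rule ccontr)
  assume "\<not> ?thesis"
  then have pos: "0 < h s * d s" by simp
  have mono: "(h s)\<^sup>2 \<le> (h t)\<^sup>2" if "s \<le> t" for t
  proof (rule DERIV_nonneg_imp_nondecreasing[OF that])
    fix u assume "s \<le> u" "u \<le> t"
    then show "\<exists>y. ((\<lambda>t. (h t)\<^sup>2) has_real_derivative y) (at u) \<and> 0 \<le> y"
      by - (rule exI, intro conjI, rule square_deriv,
        use square_deriv_mono[of s u] assms pos in auto)
  qed
  define g where "g = (h s)\<^sup>2"
  have g: "0 < g" using pos by (auto simp: g_def)
  \<comment> \<open>An interval of length \<open>1/g + 1\<close> on which \<open>h\<^sup>2 \<ge> g\<close> already carries mass above \<open>1\<close>.\<close>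
  have "(s + (1 / g + 1)) - s \<le> 1 / g"
  proof (rule increment_le_mass[where F' = "\<lambda>_. 1"])
    fix t assume "s \<le> t"
    then have "g \<le> (h t)\<^sup>2" using mono by (simp add: g_def)
    then show "1 \<le> 1 / g * (h t)\<^sup>2" using g by (simp add: field_simps)
  qed (use g assms r_pos in auto)
  then show False by simp
qed

lemma square_antimono:
  assumes "r \<le> s" "s \<le> t"
  shows "(h t)\<^sup>2 \<le> (h s)\<^sup>2"
proof (rule DERIV_nonpos_imp_nonincreasing[OF assms(2)])
  fix u assume "s \<le> u"
  then show "\<exists>y. ((\<lambda>t. (h t)\<^sup>2) has_real_derivative y) (at u) \<and> y \<le> 0"
    by - (rule exI, intro conjI, rule square_deriv, use square_deriv_nonpos[of u] assms in \<open>simp_all add: mult.commute\<close>)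
qed

text \<open>The Sonin-type energy of the equation, multiplied by the potential so that it stays finite
  at the turning point.\<close>

definition energy :: "real \<Rightarrow> real" where
  "energy t = 4 * pi\<^sup>2 * (r\<^sup>2 - t\<^sup>2) * (h t)\<^sup>2 + (d t)\<^sup>2"

lemma energy_deriv: "(energy has_real_derivative - 8 * pi\<^sup>2 * t * (h t)\<^sup>2) (at t)"
  unfolding energy_def [abs_def]
  by (rule derivative_eq_intros h_deriv d_deriv refl
      | simp add: power2_eq_square algebra_simps)+

lemma energy_antimono:
  assumes "0 \<le> t"
  shows "energy t \<le> energy 0"
proof (rule DERIV_nonpos_imp_nonincreasing[OF assms])
  fix u assume "0 \<le> (u::real)"
  then show "\<exists>y. (energy has_real_derivative y) (at u) \<and> y \<le> 0"
    by - (rule exI, intro conjI, rule energy_deriv, auto)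
qed

text \<open>Both parts cost \<open>8\<pi>\<^sup>2 r\<close>. The loss of energy over \<open>[0, r]\<close> is \<open>\<integral> 8\<pi>\<^sup>2 t h\<^sup>2 \<le> 8\<pi>\<^sup>2 r\<close>. The energy
  left at \<open>r\<close> is found from the virial identity \<open>(t E - h h')' = (8\<pi>\<^sup>2 r\<^sup>2 - 16\<pi>\<^sup>2 t\<^sup>2) h\<^sup>2\<close>: the
  boundary term at \<open>0\<close> vanishes and the one at \<open>r\<close> has the favourable sign, because \<open>h\<^sup>2\<close> is
  decreasing there.\<close>

lemma energy_0_le: "energy 0 \<le> 16 * pi\<^sup>2 * r"
proof -
  have "(- energy r) - (- energy 0) \<le> 8 * pi\<^sup>2 * r"
  proof (rule increment_le_mass[where F = "\<lambda>t. - energy t" and F' = "\<lambda>t. 8 * pi\<^sup>2 * t * (h t)\<^sup>2"])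
    show "((\<lambda>t. - energy t) has_real_derivative 8 * pi\<^sup>2 * t * (h t)\<^sup>2) (at t)" for t
      by (rule derivative_eq_intros energy_deriv refl | simp)+
    show "8 * pi\<^sup>2 * t * (h t)\<^sup>2 \<le> 8 * pi\<^sup>2 * r * (h t)\<^sup>2" if "0 \<le> t" "t \<le> r" for t
      using that by (intro mult_right_mono mult_left_mono) auto
  qed (use r_pos in auto)
  moreover have "(r * energy r - h r * d r) - (0 * energy 0 - h 0 * d 0) \<le> 8 * pi\<^sup>2 * r\<^sup>2"
  proof (rule increment_le_mass[where F = "\<lambda>t. t * energy t - h t * d t"
        and F' = "\<lambda>t. (8 * pi\<^sup>2 * r\<^sup>2 - 16 * pi\<^sup>2 * t\<^sup>2) * (h t)\<^sup>2"])
    show "((\<lambda>t. t * energy t - h t * d t) has_real_derivative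
        (8 * pi\<^sup>2 * r\<^sup>2 - 16 * pi\<^sup>2 * t\<^sup>2) * (h t)\<^sup>2) (at t)" for t
      by (rule derivative_eq_intros energy_deriv h_deriv d_deriv refl
          | simp add: energy_def power2_eq_square algebra_simps)+
    show "(8 * pi\<^sup>2 * r\<^sup>2 - 16 * pi\<^sup>2 * t\<^sup>2) * (h t)\<^sup>2 \<le> 8 * pi\<^sup>2 * r\<^sup>2 * (h t)\<^sup>2" for t
      by (intro mult_right_mono) auto
  qed (use r_pos in auto)
  then have "r * energy r \<le> r * (8 * pi\<^sup>2 * r)"
    using flat_at_0 square_deriv_nonpos[of r] unfolding power2_eq_square by (simp only: ac_simps) linarith
  then have "energy r \<le> 8 * pi\<^sup>2 * r" using r_pos by simp
  ultimately show ?thesis by simp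
qed

lemma energy_le: "0 \<le> t \<Longrightarrow> energy t \<le> 16 * pi\<^sup>2 * r"
  using energy_antimono energy_0_le order_trans by blast

text \<open>The potential part of the energy alone; the factor \<open>r + t \<ge> r\<close> of \<open>r\<^sup>2 - t\<^sup>2\<close> cancels the \<open>r\<close> in
  the energy bound.\<close>

lemma abs_le_inside:
  assumes "0 \<le> t" "t < r"
  shows "\<bar>h t\<bar> \<le> 2 / sqrt (r - t)"
proof -
  have "(r - t) * r * (h t)\<^sup>2 \<le> (r\<^sup>2 - t\<^sup>2) * (h t)\<^sup>2"
    using assms by (intro mult_right_mono) (auto simp: power2_eq_square algebra_simps mult_right_mono)
  also have "\<dots> \<le> 4 * r"
  proof -
    have "4 * pi\<^sup>2 * ((r\<^sup>2 - t\<^sup>2) * (h t)\<^sup>2) \<le> 4 * pi\<^sup>2 * (4 * r)"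
      using energy_le[OF assms(1)] zero_le_power2[of "d t"] unfolding energy_def by argo
    then show ?thesis by (subst (asm) mult_le_cancel_left_pos) auto
  qed
  finally have "r * ((r - t) * (h t)\<^sup>2) \<le> r * 4" by (simp add: algebra_simps)
  then have "(r - t) * (h t)\<^sup>2 \<le> 4" using r_pos by simp
  then have "(h t)\<^sup>2 \<le> (2 / sqrt (r - t))\<^sup>2"
    using assms by (simp add: power_divide field_simps)
  then show ?thesis using assms by (subst (asm) power2_le_iff_abs_le) auto
qed

lemma deriv_abs_le:
  assumes "0 \<le> t" "t \<le> r"
  shows "\<bar>d t\<bar> \<le> 4 * pi * sqrt r"
proof -
  have "0 \<le> 4 * pi\<^sup>2 * (r\<^sup>2 - t\<^sup>2) * (h t)\<^sup>2"
    using assms by (intro mult_nonneg_nonneg) (auto simp: power_mono)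
  then have "(d t)\<^sup>2 \<le> 16 * pi\<^sup>2 * r"
    using energy_le[OF assms(1)] unfolding energy_def by linarith
  also have "\<dots> = (4 * pi * sqrt r)\<^sup>2" using r_pos by (simp add: power_mult_distrib)
  finally show ?thesis using r_pos by (subst (asm) power2_le_iff_abs_le) auto
qed

text \<open>Before the turning point, stepping back by at most \<open>1\<close> leads to a point \<open>s\<close> at distance at
  least \<open>1/3\<close> from \<open>r\<close>, where \<open>h\<close> is bounded by a constant; the step costs at most
  \<open>sup |h'| \<le> 4\<pi> r\<^sup>1\<^sup>/\<^sup>2\<close>. Past the turning point \<open>|h|\<close> decreases.\<close>

lemma abs_le_sup:
  assumes "0 \<le> t"
  shows "\<bar>h t\<bar> \<le> 24 * sqrt r"
proof -
  have inside: "\<bar>h t\<bar> \<le> 24 * sqrt r" if t: "0 \<le> t" "t \<le> r" for t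
  proof -
    define s where "s = max 0 (t - 1)"
    have s: "0 \<le> s" "s \<le> t" "t - s \<le> 1" "1 / 3 \<le> r - s" using t r_ge by (simp_all add: s_def max_def)
    have "\<bar>h t - h s\<bar> \<le> 4 * pi * sqrt r"
    proof (cases "s = t")
      case False
      then have "s < t" using s by simp
      then obtain z where z: "s < z" "z < t" "h t - h s = (t - s) * d z"
        using MVT2[of s t h d] h_deriv by blast
      have "\<bar>h t - h s\<bar> = (t - s) * \<bar>d z\<bar>" using z s by (simp add: abs_mult)
      also have "\<dots> \<le> 1 * (4 * pi * sqrt r)"
        using deriv_abs_le[of z] z s t by (intro mult_mono) auto
      finally show ?thesis by simp
    qed (use r_pos in simp)
    also have "4 * pi * sqrt r \<le> 16 * sqrt r"
      using pi_less_4 r_pos by (intro mult_right_mono) auto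
    finally have 1: "\<bar>h t - h s\<bar> \<le> 16 * sqrt r" .
    have "sqrt (1 / 4) \<le> sqrt r" "sqrt (1 / 4) \<le> sqrt (r - s)"
      using r_ge s(4) by (intro real_sqrt_le_mono; simp)+
    then have sq: "1 / 2 \<le> sqrt r" "1 / 2 \<le> sqrt (r - s)" by (simp_all add: real_sqrt_divide)
    have "\<bar>h s\<bar> \<le> 2 / sqrt (r - s)" using s r_ge by (intro abs_le_inside) auto
    also have "\<dots> \<le> 2 / (1 / 2)" using sq s(4) by (intro divide_left_mono mult_pos_pos) auto
    also have "\<dots> \<le> 8 * sqrt r" using sq by simp
    finally show ?thesis using 1 by linarith
  qed
  show ?thesis
  proof (cases "t \<le> r")
    case False
    then have "(h t)\<^sup>2 \<le> (h r)\<^sup>2" by (intro square_antimono) auto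
    then have "\<bar>h t\<bar> \<le> \<bar>h r\<bar>" by (simp add: abs_le_square_iff)
    then show ?thesis using inside[of r] r_pos by simp
  qed (use inside assms in auto)
qed

text \<open>At distance \<open>1\<close> past the turning point, \<open>(h\<^sup>2)'' \<ge> 8\<pi>\<^sup>2 h\<^sup>2 \<ge> 15 h\<^sup>2\<close>. Over \<open>[t + 1, t + 2]\<close> this
  makes the slope of \<open>h\<^sup>2\<close> at \<open>t + 1\<close> at most \<open>-15 h(t + 2)\<^sup>2\<close>; convexity carries this slope back to
  \<open>[t, t + 1]\<close>, so that \<open>h(t)\<^sup>2 \<ge> 16 h(t + 2)\<^sup>2\<close>.\<close>

lemma abs_decay_step:
  assumes "r + 1 \<le> t"
  shows "\<bar>h (t + 2)\<bar> \<le> \<bar>h t\<bar> / 4"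
proof -
  obtain z where z: "t + 1 < z" "z < t + 2"
    "2 * (h (t + 2) * d (t + 2)) - 2 * (h (t + 1) * d (t + 1)) =
      2 * (d z)\<^sup>2 + 8 * pi\<^sup>2 * (z\<^sup>2 - r\<^sup>2) * (h z)\<^sup>2"
    using MVT2[of "t + 1" "t + 2", OF _ square_deriv2] by (auto simp: add_diff_eq)
  obtain y where y: "t < y" "y < t + 1"
    "(h (t + 1))\<^sup>2 - (h t)\<^sup>2 = 2 * (h y * d y)"
    using MVT2[of "t" "t + 1", OF _ square_deriv] by auto
  have "(r + 1)\<^sup>2 \<le> z\<^sup>2" using z assms r_pos by (intro power_mono) auto
  then have z1: "1 \<le> z\<^sup>2 - r\<^sup>2" using r_pos by (simp add: power2_eq_square algebra_simps)
  have "2\<^sup>2 \<le> pi\<^sup>2" using pi_ge_two by (intro power_mono) auto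
  then have "15 \<le> 8 * pi\<^sup>2 * 1" by simp
  also have "\<dots> \<le> 8 * pi\<^sup>2 * (z\<^sup>2 - r\<^sup>2)" using z1 by (intro mult_left_mono) auto
  finally have "15 * (h (t + 2))\<^sup>2 \<le> 8 * pi\<^sup>2 * (z\<^sup>2 - r\<^sup>2) * (h z)\<^sup>2"
    using square_antimono[of z "t + 2"] z assms by (intro mult_mono) auto
  moreover have "h (t + 2) * d (t + 2) \<le> 0" using assms by (intro square_deriv_nonpos) auto
  moreover have "h y * d y \<le> h (t + 1) * d (t + 1)"
    using y assms by (intro square_deriv_mono) auto
  moreover have "(h (t + 2))\<^sup>2 \<le> (h (t + 1))\<^sup>2" using assms by (intro square_antimono) auto
  moreover have "0 \<le> (d z)\<^sup>2" by simp
  ultimately have "16 * (h (t + 2))\<^sup>2 \<le> (h t)\<^sup>2" using y(3) z(3) by argo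
  then have "(h (t + 2))\<^sup>2 \<le> (h t / 4)\<^sup>2" by (simp add: power_divide)
  then have "\<bar>h (t + 2)\<bar> \<le> \<bar>h t / 4\<bar>" by (simp only: abs_le_square_iff)
  then show ?thesis by simp
qed

text \<open>A factor \<open>1/4\<close> per two units is a factor \<open>1/2\<close> per unit, once the supremum bound is doubled to
  cover the two initial values of \<open>j\<close>.\<close>

lemma abs_le_outside:
  "r + 1 + real j \<le> t \<Longrightarrow> \<bar>h t\<bar> \<le> 48 * sqrt r * (1 / 2) ^ j"
proof (induction j arbitrary: t rule: induct_nat_012)
  case (ge2 j)
  have "\<bar>h (t - 2)\<bar> \<le> 48 * sqrt r * (1 / 2) ^ j" using ge2(3) by (intro ge2(1)) auto
  then show ?case using abs_decay_step[of "t - 2"] ge2(3) by simp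
next
  case 0
  then show ?case using abs_le_sup[of t] r_pos by simp
next
  case 1
  then show ?case using abs_le_sup[of t] r_pos by simp
qed

text \<open>A bound for \<open>|h|\<close> on \<open>[k, k + 1]\<close>. In the second branch the truncated subtraction turns the
  power into \<open>1\<close> for the (at most three) intervals around the turning point, where only the supremum bound
  is available. Uniformity in the position of the lattice inside the unit cell is what bounds the Zak
  transform for all \<open>x\<close> at once.\<close>

definition unit_bound :: "nat \<Rightarrow> real" where
  "unit_bound k = (let m = nat \<lfloor>r\<rfloor> in
     if k + 2 \<le> m then 2 / sqrt (real (m - 1 - k)) else 48 * sqrt r * (1 / 2) ^ (k - (m + 2)))"

lemma abs_le_unit_bound:
  assumes "real k \<le> t" "t \<le> real k + 1"
  shows "\<bar>h t\<bar> \<le> unit_bound k"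
proof -
  define m where "m = nat \<lfloor>r\<rfloor>"
  have m: "real m \<le> r" "r < real m + 1" using r_pos by (auto simp: m_def)
  show ?thesis
  proof (cases "k + 2 \<le> m")
    case True
    then have k: "real (m - 1 - k) = real m - 1 - real k" "real k + 2 \<le> real m"
      by (auto simp: of_nat_diff)
    have "\<bar>h t\<bar> \<le> 2 / sqrt (r - t)" using k m assms by (intro abs_le_inside) linarith+
    also have "\<dots> \<le> 2 / sqrt (real (m - 1 - k))"
      using k m assms by (intro divide_left_mono real_sqrt_le_mono mult_pos_pos) auto
    finally show ?thesis using True by (simp add: unit_bound_def m_def Let_def)
  next
    case False
    have "\<bar>h t\<bar> \<le> 48 * sqrt r * (1 / 2) ^ (k - (m + 2))"
    proof (cases "k \<ge> m + 2")
      case True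
      then show ?thesis using m assms by (intro abs_le_outside) (auto simp: of_nat_diff)
    next
      case False
      have "0 \<le> t" using assms by linarith
      then show ?thesis using False abs_le_sup[of t] r_pos by simp
    qed
    then show ?thesis using False by (simp add: unit_bound_def m_def Let_def)
  qed
qed

lemma unit_bound_nonneg: "0 \<le> unit_bound k"
proof -
  have "0 \<le> 2 / sqrt (real i)" for i by simp
  then show ?thesis using r_pos by (simp add: unit_bound_def Let_def del: of_nat_diff)
qed

end

section \<open>Lattice sums\<close>

lemma sum_inverse_sqrt_le: "(\<Sum>j = 1..m. 1 / sqrt (real j)) \<le> 2 * sqrt (real m)"
proof (induction m)
  case (Suc m)
  define u v where "u = sqrt (real m)" and "v = sqrt (real (Suc m))"
  have uv: "0 \<le> u" "u \<le> v" "0 < v" "v * v - u * u = 1" by (auto simp: u_def v_def)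
  have "1 = (v - u) * (v + u)" using uv by (simp add: algebra_simps)
  also have "\<dots> \<le> (v - u) * (2 * v)" using uv by (intro mult_left_mono) auto
  finally have "1 / v \<le> 2 * v - 2 * u" using uv by (simp add: field_simps)
  then show ?case using Suc by (simp add: u_def v_def)
qed simp

lemma sum_half_powers_le: "(\<Sum>i<K. (1 / 2 :: real) ^ i) \<le> 2"
proof -
  have "(\<Sum>i<K. (1 / 2 :: real) ^ i) = 2 - 2 * (1 / 2) ^ K" by (induction K) auto
  then show ?thesis by simp
qed

context oscillator_solution begin

text \<open>The intervals up to the turning point contribute at most \<open>2 \<Sum> j\<^sup>-\<^sup>1\<^sup>/\<^sup>2 \<le> 4 r\<^sup>1\<^sup>/\<^sup>2\<close>, and the remaining ones
  \<open>48 r\<^sup>1\<^sup>/\<^sup>2\<close> times \<open>3\<close> (around the turning point) plus \<open>2\<close> (geometric tail).\<close>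

lemma sum_unit_bound_le: "(\<Sum>k<K. unit_bound k) \<le> 244 * sqrt r"
proof -
  define m where "m = nat \<lfloor>r\<rfloor>"
  have m: "real m \<le> r" using r_pos by (auto simp: m_def)
  define f g :: "nat \<Rightarrow> real" where "f k = 2 / sqrt (real (m - 1 - k))"
    and "g k = 48 * sqrt r * (1 / 2) ^ (k - (m + 2))" for k
  have g: "0 \<le> g k" for k using r_pos by (simp add: g_def)
  have "(\<Sum>k<K. unit_bound k) \<le> (\<Sum>k<(m - 1) + (K + 3). unit_bound k)"
    by (rule sum_mono2) (auto simp: unit_bound_nonneg)
  also have "\<dots> = (\<Sum>k<m - 1. unit_bound k) + (\<Sum>i<K + 3. unit_bound (m - 1 + i))"
    by (induction K) (simp_all add: eval_nat_numeral add.assoc)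
  also have "(\<Sum>k<m - 1. unit_bound k) = (\<Sum>k<m - 1. f k)"
    by (rule sum.cong) (auto simp: unit_bound_def f_def m_def Let_def)
  also have "\<dots> = 2 * (\<Sum>j = 1..m - 1. 1 / sqrt (real j))"
    unfolding sum_distrib_left f_def
    by (rule sum.reindex_bij_witness[of _ "\<lambda>j. m - 1 - j" "\<lambda>k. m - 1 - k"]) auto
  also have "\<dots> \<le> 2 * (2 * sqrt (real (m - 1)))" using sum_inverse_sqrt_le by simp
  also have "\<dots> \<le> 4 * sqrt r" using m by simp
  also have "(\<Sum>i<K + 3. unit_bound (m - 1 + i)) = (\<Sum>i<K + 3. g (m - 1 + i))"
    by (rule sum.cong) (auto simp: unit_bound_def g_def m_def Let_def)
  also have "\<dots> \<le> (\<Sum>i<K + 3. 48 * sqrt r * (1 / 2) ^ (i - 3))"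
    unfolding g_def using r_pos
    by (intro sum_mono mult_left_mono power_decreasing) auto
  also have "\<dots> = 48 * sqrt r * (3 + (\<Sum>i<K. (1 / 2) ^ i))"
  proof -
    have "(\<Sum>i<K + 3. (1 / 2 :: real) ^ (i - 3)) = 3 + (\<Sum>i<K. (1 / 2) ^ i)"
      by (induction K) (simp_all add: eval_nat_numeral)
    then show ?thesis by (simp add: sum_distrib_left[symmetric])
  qed
  also have "\<dots> \<le> 48 * sqrt r * (3 + 2)"
    using sum_half_powers_le r_pos by (intro mult_left_mono add_left_mono) auto
  finally show ?thesis using r_pos by simp
qed

lemma summable_unit_bound: "summable unit_bound"
  and suminf_unit_bound_le: "suminf unit_bound \<le> 244 * sqrt r"
proof -
  show 1: "summable unit_bound"
    by (rule summableI_nonneg_bounded) (rule unit_bound_nonneg sum_unit_bound_le)+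
  show "suminf unit_bound \<le> 244 * sqrt r"
    by (rule suminf_le_const[OF 1 sum_unit_bound_le])
qed

end

section \<open>Hermite functions\<close>

text \<open>The polynomial factor of the \<open>n\<close>-th derivative of \<open>exp (-2\<pi> t\<^sup>2)\<close>.\<close>

primrec rodrigues_poly :: "nat \<Rightarrow> real poly" where
  "rodrigues_poly 0 = 1"
| "rodrigues_poly (Suc n) = pderiv (rodrigues_poly n) - [:0, 4 * pi:] * rodrigues_poly n"

lemma hermite_unnorm_eq:
  "hermite_unnorm n t = poly (rodrigues_poly n) t * exp (- pi * t\<^sup>2)"
proof -
  have *: "(deriv ^^ n) (\<lambda>s. exp (- 2 * pi * s\<^sup>2))
    = (\<lambda>t. poly (rodrigues_poly n) t * exp (- 2 * pi * t\<^sup>2))"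
  proof (induction n)
    case (Suc n)
    have "deriv (\<lambda>t. poly (rodrigues_poly n) t * exp (- 2 * pi * t\<^sup>2)) t
      = poly (rodrigues_poly (Suc n)) t * exp (- 2 * pi * t\<^sup>2)" for t
      by (rule DERIV_imp_deriv, (rule derivative_eq_intros poly_DERIV refl | simp)+)
        (simp add: power2_eq_square algebra_simps)
    then show ?case by (simp only: funpow.simps(2) o_apply Suc)
  qed simp
  have "exp (pi * t\<^sup>2) * exp (- 2 * pi * t\<^sup>2) = exp (- pi * t\<^sup>2)"
    by (simp add: exp_add[symmetric])
  then show ?thesis unfolding hermite_unnorm_def * by (simp only: mult.left_commute)
qed

text \<open>The two statements support each other: the Hermite equation at \<open>n\<close> gives the lowering relation
  from \<open>n + 1\<close> to \<open>n\<close> by differentiating the recursion, and differentiating the lowering relation gives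
  the equation at \<open>n + 1\<close>.\<close>

lemma rodrigues_poly_ode:
  "pderiv (pderiv (rodrigues_poly n)) =
    [:0, 4 * pi:] * pderiv (rodrigues_poly n) - smult (4 * pi * real n) (rodrigues_poly n)"
  and pderiv_rodrigues_poly_Suc:
    "pderiv (rodrigues_poly (Suc n)) = smult (- (4 * pi * real (Suc n))) (rodrigues_poly n)"
proof -
  have step: "pderiv (rodrigues_poly (Suc n)) = smult (- (4 * pi * real (Suc n))) (rodrigues_poly n)"
    if "pderiv (pderiv (rodrigues_poly n)) =
      [:0, 4 * pi:] * pderiv (rodrigues_poly n) - smult (4 * pi * real n) (rodrigues_poly n)" for n
    using that
    by (simp add: pderiv_diff pderiv_mult pderiv_pCons pderiv_smult algebra_simps
        smult_add_left smult_diff_left)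
  show ode: "pderiv (pderiv (rodrigues_poly n)) =
    [:0, 4 * pi:] * pderiv (rodrigues_poly n) - smult (4 * pi * real n) (rodrigues_poly n)" for n
  proof (induction n)
    case (Suc n)
    have "pderiv (pderiv (rodrigues_poly (Suc n)))
      = smult (- (4 * pi * real (Suc n))) (pderiv (rodrigues_poly n))"
      unfolding step[OF Suc] by (rule pderiv_smult)
    also have "pderiv (rodrigues_poly n) = rodrigues_poly (Suc n) + [:0, 4 * pi:] * rodrigues_poly n"
      by simp
    also have "smult (- (4 * pi * real (Suc n))) \<dots> =
      [:0, 4 * pi:] * smult (- (4 * pi * real (Suc n))) (rodrigues_poly n)
        - smult (4 * pi * real (Suc n)) (rodrigues_poly (Suc n))"
      unfolding smult_add_right by (simp only: mult_smult_right smult_minus_left) simp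
    finally show ?case unfolding step[OF Suc, symmetric] .
  qed simp
  show "pderiv (rodrigues_poly (Suc n)) = smult (- (4 * pi * real (Suc n))) (rodrigues_poly n)"
    by (rule step[OF ode])
qed

text \<open>By the lowering relation, if one of these polynomials vanished, so would all earlier
  ones, down to the constant \<open>1\<close>.\<close>

lemma rodrigues_poly_nonzero: "rodrigues_poly n \<noteq> 0"
proof (induction n)
  case (Suc n)
  then show ?case using pderiv_rodrigues_poly_Suc[of n]
    by (metis pderiv_0 smult_eq_0_iff mult_eq_0_iff neg_equal_0_iff_equal of_nat_eq_0_iff
        old.nat.distinct(2) pi_neq_zero zero_neq_numeral)
qed simp

lemma poly_rodrigues_poly_minus: "poly (rodrigues_poly n) (- t) = (- 1) ^ n * poly (rodrigues_poly n) t"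
proof -
  have "pcompose (rodrigues_poly n) [:0, - 1:] = smult ((- 1) ^ n) (rodrigues_poly n)"
  proof (induction n)
    case (Suc n)
    have "pderiv (rodrigues_poly n \<circ>\<^sub>p [:0, - 1:]) = - (pderiv (rodrigues_poly n) \<circ>\<^sub>p [:0, - 1:])"
      by (simp add: pderiv_pcompose pderiv_pCons)
    then have "pderiv (rodrigues_poly n) \<circ>\<^sub>p [:0, - 1:] = - smult ((- 1) ^ n) (pderiv (rodrigues_poly n))"
      using Suc by (simp add: pderiv_smult)
    then show ?case using Suc
      by (simp add: pcompose_diff pcompose_mult pcompose_pCons pcompose_smult smult_diff_right mult.commute)
  qed (simp add: one_pCons pcompose_pCons)
  from arg_cong[OF this, of "\<lambda>p. poly p t"] show ?thesis by (simp add: poly_pcompose)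
qed

text \<open>Up to a constant, \<open>exp (-2\<pi> t\<^sup>2)\<close> is the normal density of variance \<open>1/(4\<pi>)\<close>, all of whose
  moments exist.\<close>

lemma integrable_poly_gaussian:
  "integrable lborel (\<lambda>t. poly p t * exp (- 2 * pi * t\<^sup>2))"
proof -
  define \<sigma> where "\<sigma> = sqrt (1 / (4 * pi))"
  have \<sigma>: "0 < \<sigma>" "\<sigma>\<^sup>2 = 1 / (4 * pi)" by (auto simp: \<sigma>_def)
  have dens: "exp (- 2 * pi * t\<^sup>2) = sqrt (2 * pi * \<sigma>\<^sup>2) * normal_density 0 \<sigma> t" for t
    by (simp add: normal_density_def \<sigma> mult.commute)
  have "integrable lborel (\<lambda>t. \<Sum>i\<le>degree p. (coeff p i * sqrt (2 * pi * \<sigma>\<^sup>2)) *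
      (normal_density 0 \<sigma> t * (t - 0) ^ i))"
    by (intro Bochner_Integration.integrable_sum integrable_mult_right integrable_normal_moment \<sigma>)
  also have "(\<lambda>t. \<Sum>i\<le>degree p. (coeff p i * sqrt (2 * pi * \<sigma>\<^sup>2)) *
      (normal_density 0 \<sigma> t * (t - 0) ^ i)) = (\<lambda>t. poly p t * exp (- 2 * pi * t\<^sup>2))"
    unfolding dens poly_altdef sum_distrib_right by (simp add: mult_ac)
  finally show ?thesis .
qed

lemma hermite_unnorm_square:
  "(hermite_unnorm n t)\<^sup>2 = poly (rodrigues_poly n * rodrigues_poly n) t * exp (- 2 * pi * t\<^sup>2)"
  by (simp add: hermite_unnorm_eq power2_eq_square exp_add[symmetric] algebra_simps mult_exp_exp)

lemma integrable_hermite_unnorm_square: "integrable lebesgue (\<lambda>t. (hermite_unnorm n t)\<^sup>2)"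
  unfolding hermite_unnorm_square
  by (subst integrable_completion[OF borel_measurable_integrable]) (rule integrable_poly_gaussian)+

text \<open>The norm can only vanish if the function does almost everywhere, but the polynomial factor has
  finitely many zeros.\<close>

lemma L2_norm_hermite_unnorm_pos: "0 < L2_norm (hermite_unnorm n)"
proof -
  have "(\<integral>t. (hermite_unnorm n t)\<^sup>2 \<partial>lebesgue) \<noteq> 0"
  proof
    assume "(\<integral>t. (hermite_unnorm n t)\<^sup>2 \<partial>lebesgue) = 0"
    then have "AE t in lebesgue. (hermite_unnorm n t)\<^sup>2 = 0"
      using integrable_hermite_unnorm_square by (subst (asm) integral_nonneg_eq_0_iff_AE) auto
    moreover have "AE t in lebesgue. t \<notin> {t. poly (rodrigues_poly n) t = 0}"
      using poly_roots_finite[OF rodrigues_poly_nonzero]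
      by (intro AE_not_in) (simp add: negligible_iff_null_sets[symmetric] negligible_finite)
    ultimately have "AE t in (lebesgue :: real measure). False"
      by eventually_elim (simp add: hermite_unnorm_eq)
    then show False by (simp add: ae_filter_eq_bot_iff trivial_limit_def[symmetric])
  qed
  moreover have "0 \<le> (\<integral>t. (hermite_unnorm n t)\<^sup>2 \<partial>lebesgue)" by simp
  ultimately show ?thesis unfolding L2_norm_def by (simp only: real_sqrt_gt_0_iff less_le) simp
qed

lemma L2_norm_cmult: "L2_norm (\<lambda>t. c * f t) = \<bar>c\<bar> * L2_norm f"
  by (simp add: L2_norm_def power_mult_distrib real_sqrt_mult)

text \<open>A finite, positive norm makes the description defining the normalising constant uniquely
  satisfiable.\<close>

lemma L2_norm_hermite_fun: "L2_norm (hermite_fun n) = 1"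
proof -
  define L where "L = L2_norm (hermite_unnorm n)"
  have L: "0 < L" using L2_norm_hermite_unnorm_pos by (simp add: L_def)
  have "sgn c = (- 1) ^ n \<and> L2_norm (\<lambda>t. c * hermite_unnorm n t) = 1 \<longleftrightarrow> c = (- 1) ^ n / L" for c
  proof -
    have "\<bar>c\<bar> * L = 1 \<longleftrightarrow> \<bar>c\<bar> = 1 / L" using L by (auto simp: field_simps)
    moreover have "c = sgn c * \<bar>c\<bar>" by (simp add: sgn_mult_abs)
    ultimately show ?thesis using L unfolding L2_norm_cmult L_def[symmetric]
      by (auto simp: sgn_mult sgn_divide power_abs abs_divide power_sgn[symmetric])
  qed
  then have "hermite_const n = (- 1) ^ n / L" unfolding hermite_const_def by simp
  then show ?thesis
    using L unfolding hermite_fun_def[abs_def] L2_norm_cmult L_def[symmetric]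
    by (simp add: power_abs abs_divide)
qed

lemma hermite_fun_eq:
  "hermite_fun n t = hermite_const n * (poly (rodrigues_poly n) t * exp (- pi * t\<^sup>2))"
  by (simp add: hermite_fun_def hermite_unnorm_eq)

lemma hermite_fun_minus: "hermite_fun n (- t) = (- 1) ^ n * hermite_fun n t"
  by (simp add: hermite_fun_eq poly_rodrigues_poly_minus)

definition hermite_fun_deriv :: "nat \<Rightarrow> real \<Rightarrow> real" where
  "hermite_fun_deriv n t = hermite_const n *
    (poly (pderiv (rodrigues_poly n) - [:0, 2 * pi:] * rodrigues_poly n) t * exp (- pi * t\<^sup>2))"

lemma DERIV_hermite_fun: "(hermite_fun n has_real_derivative hermite_fun_deriv n t) (at t)"
  unfolding hermite_fun_eq[abs_def] hermite_fun_deriv_def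
  by (rule derivative_eq_intros poly_DERIV refl)+ (simp add: power2_eq_square algebra_simps)

text \<open>The Hermite equation of the polynomial factor, conjugated with the Gaussian; the turning point
  \<open>r\<close> is read off from the potential.\<close>

lemma DERIV_hermite_fun_deriv:
  "(hermite_fun_deriv n has_real_derivative
      4 * pi\<^sup>2 * (t\<^sup>2 - (2 * real n + 1) / (2 * pi)) * hermite_fun n t) (at t)"
proof -
  define p where "p = rodrigues_poly n"
  have ode: "poly (pderiv (pderiv p)) t = 4 * pi * t * poly (pderiv p) t - 4 * pi * real n * poly p t"
    unfolding p_def rodrigues_poly_ode by simp
  have eq: "4 * pi\<^sup>2 * (t\<^sup>2 - (2 * real n + 1) / (2 * pi)) = 4 * pi\<^sup>2 * t\<^sup>2 - 2 * pi * (2 * real n + 1)"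
    by (simp add: field_simps power2_eq_square)
  show ?thesis
    unfolding eq hermite_fun_eq hermite_fun_deriv_def[abs_def] p_def[symmetric]
    by (auto intro!: derivative_eq_intros poly_DERIV
        simp: pderiv_diff pderiv_mult pderiv_pCons ode power2_eq_square algebra_simps)
qed

lemma integral_hermite_fun_square_le: "integral {a..b} (\<lambda>t. (hermite_fun n t)\<^sup>2) \<le> 1"
proof -
  let ?f = "\<lambda>t. (hermite_fun n t)\<^sup>2"
  have int: "(?f has_integral (\<integral>t. ?f t \<partial>lebesgue)) UNIV"
    using integrable_hermite_unnorm_square[of n]
    by (intro has_integral_integral_lebesgue) (simp add: hermite_fun_def power_mult_distrib)
  have "integral {a..b} ?f \<le> integral UNIV ?f"
    using int by (intro integral_subset_le integrable_continuous_real continuous_at_imp_continuous_on)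
      (auto intro!: continuous_intros DERIV_isCont[OF DERIV_hermite_fun])
  also have "\<dots> = (\<integral>t. ?f t \<partial>lebesgue)" using int by (rule integral_unique)
  also have "\<dots> = 1" using L2_norm_hermite_fun[of n] by (simp add: L2_norm_def)
  finally show ?thesis .
qed

text \<open>\<open>h\<^sub>n\<^sup>2\<close> is an even function, so its derivative \<open>2 h\<^sub>n h\<^sub>n'\<close> vanishes at \<open>0\<close>.\<close>

lemma hermite_fun_flat_at_0: "hermite_fun n 0 * hermite_fun_deriv n 0 = 0"
proof -
  have sq: "((\<lambda>t. (hermite_fun n t)\<^sup>2) has_real_derivative 2 * (hermite_fun n t * hermite_fun_deriv n t)) (at t)" for t
    by (rule derivative_eq_intros DERIV_hermite_fun refl | simp)+
  have even: "(hermite_fun n (- t))\<^sup>2 = (hermite_fun n t)\<^sup>2" for t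
    by (simp add: hermite_fun_minus power_mult_distrib flip: power_mult)
  have "((\<lambda>t. (hermite_fun n (- t))\<^sup>2) has_real_derivative
      2 * (hermite_fun n (- 0) * hermite_fun_deriv n (- 0)) * - 1) (at 0)"
    by (rule DERIV_chain2[OF sq]) (auto intro!: derivative_eq_intros)
  then have "2 * (hermite_fun n 0 * hermite_fun_deriv n 0) = 2 * (hermite_fun n 0 * hermite_fun_deriv n 0) * - 1"
    unfolding even by (intro DERIV_unique[OF sq]) simp
  then show ?thesis by simp
qed

section \<open>The Zak transform\<close>

text \<open>The set where the continuous partial sums form a Cauchy sequence is measurable, and off this
  set the limit operator takes a fixed value.\<close>

lemma Zak_measurable:
  assumes "continuous_on UNIV f"
  shows "Zak f \<in> borel_measurable (lebesgue_on A)"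
proof -
  have "Zak f \<in> borel_measurable lborel"
    unfolding Zak_def case_prod_beta'
    by (intro borel_measurable_lim_metric, simp, intro borel_measurable_continuous_onI)
      (auto intro!: continuous_intros continuous_on_compose2[OF assms])
  then have "Zak f \<in> borel_measurable lebesgue" by (intro measurable_completion) simp
  then show ?thesis by (rule measurable_restrict_space1)
qed

text \<open>For \<open>x\<close> in \<open>[0, 1]\<close> the points \<open>x + k\<close> and \<open>x - k - 1\<close> with \<open>k \<ge> 0\<close> both have absolute value in
  \<open>[k, k + 1]\<close>. Splitting the series at this place therefore gives two series, each dominated by
  \<open>b\<close>; the symmetric partial sums contain one more term of the first than of the second.\<close>

lemma norm_Zak_le:
  assumes b: "summable b"
    and f: "\<And>k t. real k \<le> \<bar>t\<bar> \<Longrightarrow> \<bar>t\<bar> \<le> real k + 1 \<Longrightarrow> norm (f t) \<le> b k"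
    and x: "0 \<le> x" "x \<le> 1"
  shows "norm (Zak f (x, y)) \<le> 2 * suminf b"
proof -
  define F where "F k = f (x + of_int k) * exp (2 * of_real pi * \<i> * of_int k * of_real y)" for k :: int
  have norm_F: "norm (F k) = norm (f (x + of_int k))" for k
  proof -
    have "2 * of_real pi * \<i> * of_int k * of_real y = \<i> * of_real (2 * pi * of_int k * y)" by simp
    then show ?thesis unfolding F_def norm_mult by (simp only: norm_exp_i_times mult_1_right)
  qed
  have pos: "norm (F (int k)) \<le> b k" for k
    unfolding norm_F using x by (intro f) auto
  have neg: "norm (F (- int k - 1)) \<le> b k" for k
    unfolding norm_F using x by (intro f) auto
  have sums: "(\<lambda>N. \<Sum>k<N. F (int k)) \<longlonglongrightarrow> (\<Sum>k. F (int k))"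
    "(\<lambda>N. \<Sum>k<N. F (- int k - 1)) \<longlonglongrightarrow> (\<Sum>k. F (- int k - 1))"
    by (intro summable_LIMSEQ summable_comparison_test'[OF b] pos neg)+
  have "(\<Sum>k = - int N..int N. F k) = (\<Sum>k<Suc N. F (int k)) + (\<Sum>k<N. F (- int k - 1))" for N
  proof (induction N)
    case (Suc N)
    have "{- int (Suc N)..int (Suc N)} = insert (- int N - 1) (insert (int (Suc N)) {- int N..int N})"
      by auto
    then show ?case using Suc by (simp add: algebra_simps)
  qed simp
  then have "Zak f (x, y) = lim (\<lambda>N. (\<Sum>k<Suc N. F (int k)) + (\<Sum>k<N. F (- int k - 1)))"
    by (simp add: Zak_def F_def)
  also have "\<dots> = (\<Sum>k. F (int k)) + (\<Sum>k. F (- int k - 1))"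
    by (intro limI tendsto_add LIMSEQ_Suc sums)
  also have "norm \<dots> \<le> norm (\<Sum>k. F (int k)) + norm (\<Sum>k. F (- int k - 1))"
    by (rule norm_triangle_ineq)
  also have "\<dots> \<le> suminf b + suminf b"
    by (intro add_mono norm_suminf_le pos neg b)
  finally show ?thesis by simp
qed

lemma oscillator_solution_hermite_fun:
  "oscillator_solution (sqrt ((2 * real n + 1) / (2 * pi))) (hermite_fun n) (hermite_fun_deriv n)"
proof
  have "(1 / 3)\<^sup>2 \<le> 1 / (2 * pi)" using pi_less_4 by (simp add: power2_eq_square field_simps)
  also have "\<dots> \<le> (2 * real n + 1) / (2 * pi)" by (intro divide_right_mono) auto
  finally show "1 / 3 \<le> sqrt ((2 * real n + 1) / (2 * pi))" by (rule real_le_rsqrt)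
  have "(sqrt ((2 * real n + 1) / (2 * pi)))\<^sup>2 = (2 * real n + 1) / (2 * pi)" by simp
  then show "(hermite_fun_deriv n has_real_derivative
    4 * pi\<^sup>2 * (t\<^sup>2 - (sqrt ((2 * real n + 1) / (2 * pi)))\<^sup>2) * hermite_fun n t) (at t)" for t
    using DERIV_hermite_fun_deriv by (simp only:)
qed (rule DERIV_hermite_fun hermite_fun_flat_at_0 integral_hermite_fun_square_le)+

theorem corollaryA3:
  shows "\<exists>C>0::real. \<forall>n::nat.
    Linfty_norm (lebesgue_on ({0..1} \<times> {0..1})) (Zak (\<lambda>t. complex_of_real (hermite_fun n t)))
      \<le> ennreal (C * (real n + 1) powr (1 / 4))"
  \<comment> \<open>\<open>488 = 2 * 244\<close>: the two halves of the line contribute the bound \<open>244 r\<^sup>1\<^sup>/\<^sup>2\<close> each.\<close>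
proof (intro exI[of _ 488] conjI allI)
  fix n
  define q where "q = (2 * real n + 1) / (2 * pi)"
  interpret oscillator_solution "sqrt q" "hermite_fun n" "hermite_fun_deriv n"
    unfolding q_def by (rule oscillator_solution_hermite_fun)
  let ?f = "\<lambda>t. complex_of_real (hermite_fun n t)"
  have cont: "continuous_on UNIV ?f"
    by (intro continuous_intros continuous_at_imp_continuous_on)
      (auto intro: DERIV_isCont[OF DERIV_hermite_fun])
  have even: "\<bar>hermite_fun n t\<bar> = \<bar>hermite_fun n \<bar>t\<bar>\<bar>" for t
    by (cases "t \<ge> 0") (auto simp: hermite_fun_minus abs_mult power_abs)
  have bound: "norm (?f t) \<le> unit_bound k" if "real k \<le> \<bar>t\<bar>" "\<bar>t\<bar> \<le> real k + 1" for k t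
    using abs_le_unit_bound[OF that] even[of t] by simp
  \<comment> \<open>\<open>q\<close> is the square of the turning point, so its fourth root is the order of the lattice sum.\<close>
  have "real n + 1 \<le> (real n + 1) * pi" using pi_ge_two by simp
  then have "2 * real n + 1 \<le> 2 * ((real n + 1) * pi)" by linarith
  then have q: "0 \<le> q" "q \<le> real n + 1" by (auto simp: q_def field_simps)
  have "sqrt (sqrt q) = q powr (1 / 4)"
    using q by (simp add: powr_half_sqrt[symmetric] powr_powr)
  also have "\<dots> \<le> (real n + 1) powr (1 / 4)" using q by (intro powr_mono2) auto
  finally have q4: "sqrt (sqrt q) \<le> (real n + 1) powr (1 / 4)" .
  have Zak_le: "norm (Zak ?f z) \<le> 488 * (real n + 1) powr (1 / 4)" if "z \<in> {0..1} \<times> {0..1}" for z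
  proof -
    obtain x y where z: "z = (x, y)" "0 \<le> x" "x \<le> 1" using \<open>z \<in> _\<close> by auto
    have "norm (Zak ?f z) \<le> 2 * suminf unit_bound"
      unfolding z(1) by (rule norm_Zak_le[OF summable_unit_bound bound z(2,3)])
    then show ?thesis using suminf_unit_bound_le q4 by linarith
  qed
  show "Linfty_norm (lebesgue_on ({0..1} \<times> {0..1})) (Zak ?f)
      \<le> ennreal (488 * (real n + 1) powr (1 / 4))"
    unfolding Linfty_norm_def
  proof (rule esssup_I)
    show "(\<lambda>z. ennreal (norm (Zak ?f z))) \<in> borel_measurable (lebesgue_on ({0..1} \<times> {0..1}))"
      using Zak_measurable[OF cont] by measurable
    show "AE z in lebesgue_on ({0..1} \<times> {0..1}).
        ennreal (norm (Zak ?f z)) \<le> ennreal (488 * (real n + 1) powr (1 / 4))"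
      by (intro AE_I2 ennreal_leI Zak_le) (simp add: space_restrict_space)
  qed
qed simp

end
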